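(* There is an absolute constant $c > 0$ such that for all integers $m \ge 1$ and $n \ge 1$, every symplectic operator $S \in \mathrm{Sp}_{2m}(\mathbb{Z}_n)$ can be written as a product of at most $c\,m^2$ symplectic row operations acting on $\mathrm{Sp}_{2m}(\mathbb{Z}_n)$. That is, $S$ decomposes into $O(m^2)$ symplectic row operations, with a bound independent of the modulus $n$.
   Context: Let $\sigma_{2m} = \begin{bmatrix} 0_m & -I_m \\ I_m & 0_m\end{bmatrix}$. $\mathrm{Sp}_{2m}(\mathbb{Z}_n)$ is the group of $2m\times 2m$ matrices $S$ over $\mathbb{Z}_n$ with $S^{T}\sigma_{2m}S = \sigma_{2m}$. Rows are indexed by $1,\dots,2m$, with indices taken modulo $2m$ (so $j+m$ denotes the row in the other half corresponding to $j$). All operators below are matrices in $\mathrm{GL}_{2m}(\mathbb{Z}_n)$ described by their action by left multiplication: $\mu_j^{(\alpha)}$ multiplies row $j$ by the unit $\alpha\in\mathbb{Z}_n^\times$; $\epsilon_{j,k}$ exchanges rows $j$ and $k$; $\chi_{j,k}$ adds row $j$ to row $k$ ($j\neq k$). The symplectic row operations are the following operators, for row indices $j \ne k$ and units $\alpha$, together with the inverses $C_{j,k}^{-1}$: (1) $M_j^{(\alpha)} = \mu_j^{(\alpha)}\mu_{j+m}^{(\alpha^{-1})}$; (2) $E_{j,k} = \epsilon_{j,k}\,\mu_k^{(-1)}$ if $j-k\equiv m \pmod{2m}$, and $E_{j,k} = \epsilon_{j,k}\,\epsilon_{j+m,k+m}$ otherwise; (3) $C_{j,k} = \chi_{j,k}$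 if $j-k\equiv m \pmod{2m}$; $C_{j,k} = \chi_{j,k}\,\chi_{k+m,j+m}^{-1}$ if $1\le j,k\le m$ or $m+1\le j,k\le 2m$; and $C_{j,k} = \chi_{j,k}\,\chi_{k+m,j+m}$ otherwise. *)

theory Defs
  imports
    "HOL-Algebra.Group"
    "HOL-Number_Theory.Cong"
    "Jordan_Normal_Form.Gauss_Jordan_Elimination"
begin

(* Z_n is modelled by the canonical representatives {0..<n}. It is not the library's
   residue_ring, whose unit 1 lies outside the carrier for n = 1. *)
definition Zn :: "nat \<Rightarrow> int monoid" where
  "Zn n = \<lparr>carrier = {0..<int n}, monoid.mult = (\<lambda>a b. (a * b) mod int n), one = 1 mod int n\<rparr>"

definition reduce_mat :: "nat \<Rightarrow> int mat \<Rightarrow> int mat" where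
  "reduce_mat n A = map_mat (\<lambda>a. a mod int n) A"

definition Mat_Zn :: "nat \<Rightarrow> nat \<Rightarrow> int mat monoid" where
  "Mat_Zn d n =
     \<lparr>carrier = {A \<in> carrier_mat d d. elements_mat A \<subseteq> {0..<int n}},
      monoid.mult = (\<lambda>A B. reduce_mat n (A * B)),
      one = reduce_mat n (1\<^sub>m d)\<rparr>"

definition GL :: "nat \<Rightarrow> nat \<Rightarrow> int mat monoid" where
  "GL d n = units_of (Mat_Zn d n)"

definition sigma_mat :: "nat \<Rightarrow> int mat" where
  "sigma_mat m = four_block_mat (0\<^sub>m m m) (- 1\<^sub>m m) (1\<^sub>m m) (0\<^sub>m m m)"

definition Sp :: "nat \<Rightarrow> nat \<Rightarrow> int mat monoid" where
  "Sp m n = (Mat_Zn (2 * m) n)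
     \<lparr>carrier := {S \<in> carrier (Mat_Zn (2 * m) n).
        reduce_mat n (transpose_mat S * sigma_mat m * S) = reduce_mat n (sigma_mat m)}\<rparr>"

(* Rows are indexed by 0, ..., 2m - 1 instead of 1, ..., 2m. *)

definition partner :: "nat \<Rightarrow> nat \<Rightarrow> nat" where
  "partner m j = (j + m) mod (2 * m)"

definition are_partners :: "nat \<Rightarrow> nat \<Rightarrow> nat \<Rightarrow> bool" where
  "are_partners m j k \<longleftrightarrow> [int j - int k = int m] (mod int (2 * m))"

definition row_mult :: "nat \<Rightarrow> nat \<Rightarrow> nat \<Rightarrow> int \<Rightarrow> int mat" where
  "row_mult m n j \<alpha> = reduce_mat n (multrow_mat (2 * m) j \<alpha>)"

definition row_swap :: "nat \<Rightarrow> nat \<Rightarrow> nat \<Rightarrow> nat \<Rightarrow> int mat" where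
  "row_swap m n j k = reduce_mat n (swaprows_mat (2 * m) j k)"

(* chi_{j,k} adds row j to row k; addrow_mat takes the target row first. *)
definition row_add :: "nat \<Rightarrow> nat \<Rightarrow> nat \<Rightarrow> nat \<Rightarrow> int mat" where
  "row_add m n j k = reduce_mat n (addrow_mat (2 * m) 1 k j)"

definition M_op :: "nat \<Rightarrow> nat \<Rightarrow> nat \<Rightarrow> int \<Rightarrow> int mat" where
  "M_op m n j \<alpha> =
     row_mult m n j \<alpha> \<otimes>\<^bsub>GL (2 * m) n\<^esub> row_mult m n (partner m j) (inv\<^bsub>Zn n\<^esub> \<alpha>)"

definition E_op :: "nat \<Rightarrow> nat \<Rightarrow> nat \<Rightarrow> nat \<Rightarrow> int mat" where
  "E_op m n j k =
     (if are_partners m j k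
      then row_swap m n j k \<otimes>\<^bsub>GL (2 * m) n\<^esub> row_mult m n k (- 1)
      else row_swap m n j k \<otimes>\<^bsub>GL (2 * m) n\<^esub> row_swap m n (partner m j) (partner m k))"

definition C_op :: "nat \<Rightarrow> nat \<Rightarrow> nat \<Rightarrow> nat \<Rightarrow> int mat" where
  "C_op m n j k =
     (if are_partners m j k
      then row_add m n j k
      else if j < m \<longleftrightarrow> k < m
      then row_add m n j k \<otimes>\<^bsub>GL (2 * m) n\<^esub>
           inv\<^bsub>GL (2 * m) n\<^esub> (row_add m n (partner m k) (partner m j))
      else row_add m n j k \<otimes>\<^bsub>GL (2 * m) n\<^esub> row_add m n (partner m k) (partner m j))"

inductive_set row_ops :: "nat \<Rightarrow> nat \<Rightarrow> int mat set" for m n where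
  M: "\<lbrakk>j < 2 * m; \<alpha> \<in> Units (Zn n)\<rbrakk> \<Longrightarrow> M_op m n j \<alpha> \<in> row_ops m n"
| E: "\<lbrakk>j < 2 * m; k < 2 * m; j \<noteq> k\<rbrakk> \<Longrightarrow> E_op m n j k \<in> row_ops m n"
| C: "\<lbrakk>j < 2 * m; k < 2 * m; j \<noteq> k\<rbrakk> \<Longrightarrow> C_op m n j k \<in> row_ops m n"
| C_inv: "\<lbrakk>j < 2 * m; k < 2 * m; j \<noteq> k\<rbrakk> \<Longrightarrow> inv\<^bsub>GL (2 * m) n\<^esub> (C_op m n j k) \<in> row_ops m n"

(* For n > 2, E_op m n j k does not preserve the form when j and k lie in different halves
   and are not partners: it reverses the sign on the two hyperbolic planes involved. Only
   the operators that act on the symplectic group are kept. *)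
definition symplectic_row_ops :: "nat \<Rightarrow> nat \<Rightarrow> int mat set" where
  "symplectic_row_ops m n = row_ops m n \<inter> carrier (Sp m n)"

end

(*
  Let T be the transvection that adds a times row j to row k, together with the companion
  operation that makes it symplectic. Its coefficient a is arbitrary: every residue is a signed
  sum of at most 27 squares of units, a signed unit square s * u^2 comes from the coefficient s
  by conjugation with M_j, and coefficients add under composition, so T costs at most 81 row
  operations.

  Hence it suffices to reduce S to the identity with O(m^2) transvections and dilations M_j. For a
  column with entries x and y there is t such that a prime divisor of n dividing x + t * y divides
  both x and y (the stable range condition of Z_n), so adding multiples of the other rows to row j
  makes the j-th entry of a unimodular column a unit. Scaling it to 1 and clearing the column takes
  O(m) further steps, and the form then forces the entry of column j + m in row j + m to be 1, so
  that this column is cleared as well. The remaining columns are orthogonal to these two and have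
  no entries in rows j and j + m.
*)
theory Submission
  imports Defs
begin

section \<open>Units and prime divisors of the modulus\<close>

lemma coprime_if_no_prime_divisor:
  assumes n: "n > 0"
    and u: "\<And>q. prime q \<Longrightarrow> q dvd n \<Longrightarrow> \<not> int q dvd u"
  shows "coprime u (int n)"
proof (rule ccontr)
  assume "\<not> coprime u (int n)"
  then have "nat (gcd u (int n)) \<noteq> 1"
    by (auto simp: coprime_iff_gcd_eq_1)
  then obtain q where q: "prime q" "q dvd nat (gcd u (int n))"
    using prime_factor_nat by blast
  then have *: "int q dvd gcd u (int n)"
    using n by (simp add: dvd_nat_abs_iff int_dvd_int_iff [symmetric] del: int_dvd_int_iff)
  then have "q dvd n" "int q dvd u"
    by (auto simp flip: int_dvd_int_iff)
  with u q show False
    by blast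
qed

text \<open>Being a unit modulo \<open>n\<close> is visible modulo the primes dividing
  \<open>n\<close>, so a condition can be met at each prime separately and the local choices glued
  by the Chinese remainder theorem; prime powers never enter.\<close>

lemma crt_prime_divisors:
  assumes n: "(n::nat) > 0"
    and ex: "\<And>q. prime q \<Longrightarrow> q dvd n \<Longrightarrow> \<exists>y::int. P q y"
    and cong: "\<And>q y z. [y = z] (mod int q) \<Longrightarrow> P q y \<Longrightarrow> P q z"
  shows "\<exists>y. \<forall>q. prime q \<longrightarrow> q dvd n \<longrightarrow> P q y"
proof -
  define A where "A = {q. prime q \<and> q dvd n}"
  have fin: "finite A"
    unfolding A_def using n by (auto intro: finite_subset [OF _ finite_divisors_nat])
  obtain f where f: "\<And>q. q \<in> A \<Longrightarrow> P q (f q)"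
    using ex unfolding A_def by (metis mem_Collect_eq)
  have "\<forall>i\<in>A. \<forall>j\<in>A. i \<noteq> j \<longrightarrow> coprime i j"
    unfolding A_def by (auto intro: primes_coprime)
  from chinese_remainder_nat [OF fin this, of "\<lambda>q. nat (f q mod int q)"]
  obtain x where x: "\<forall>i\<in>A. [x = nat (f i mod int i)] (mod i)"
    by blast
  have "P q (int x)" if q: "q \<in> A" for q
  proof (rule cong [OF _ f [OF q]])
    have "q > 0"
      using q A_def prime_gt_0_nat by auto
    then have "int (nat (f q mod int q)) = f q mod int q"
      by simp
    with x q have "[int x = f q mod int q] (mod int q)"
      by (metis cong_int_iff)
    then show "[f q = int x] (mod int q)"
      by (simp add: cong_def)
  qed
  then show ?thesis
    unfolding A_def by blast
qed

text \<open>The residues to avoid are -3, 3, \<open>2 * t + 3\<close> and \<open>2 * t - 3\<close>.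
  Modulo 2 they are all odd, modulo 3 they coincide in pairs and leave at least one of the three
  residues free, and from 5 on there are more than four residues.\<close>

lemma avoid_four_residues:
  assumes q: "prime (q::nat)"
  shows "\<exists>y::int. \<not> int q dvd y + 3 \<and> \<not> int q dvd y - 3 \<and>
           \<not> int q dvd 2 * t - y + 3 \<and> \<not> int q dvd 2 * t - y - 3"
proof -
  consider "q = 2" | "q = 3" | "q \<ge> 5"
  proof -
    have "q \<noteq> 4"
      using q prime_product [of 2 2] by auto
    then show ?thesis
      using that prime_ge_2_nat [OF q] by linarith
  qed
  then show ?thesis
  proof cases
    case 1
    then show ?thesis
      by (intro exI [of _ 0]) simp
  next
    case 2
    have "\<exists>y::int. \<not> 3 dvd y + 3 \<and> \<not> 3 dvd y - 3 \<and> \<not> 3 dvd 2 * t - y + 3 \<and> \<not> 3 dvd 2 * t - y - 3"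
      by presburger
    with 2 show ?thesis
      by simp
  next
    case 3
    define B where "B = {- 3 mod int q, 3 mod int q, (2 * t + 3) mod int q, (2 * t - 3) mod int q}"
    have "card B \<le> 4"
      unfolding B_def by (auto simp: card_insert_if)
    then have "card B < card {0..<int q}"
      using 3 by simp
    then obtain y where y: "y \<in> {0..<int q}" "y \<notin> B"
      by (metis B_def card_mono finite.emptyI finite.insertI leD subsetI)
    have *: "y = z mod int q" if "int q dvd y - z" for z
      using that y by (metis atLeastLessThan_iff mod_eq_dvd_iff mod_pos_pos_trivial)
    have avoid: "\<not> int q dvd y - z \<and> \<not> int q dvd z - y" if "z mod int q \<in> B" for z
      using * that y dvd_diff_commute by blast
    have "\<not> int q dvd y - (-3)" "\<not> int q dvd y - 3"
      "\<not> int q dvd (2 * t + 3) - y" "\<not> int q dvd (2 * t - 3) - y"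
      using avoid [of "-3"] avoid [of 3] avoid [of "2 * t + 3"] avoid [of "2 * t - 3"]
      by (simp_all add: B_def)
    moreover have "y - (-3) = y + 3" "(2 * t + 3) - y = 2 * t - y + 3" "(2 * t - 3) - y = 2 * t - y - 3"
      by simp_all
    ultimately show ?thesis
      by metis
  qed
qed

definition signed_squares :: "(int \<times> int) list \<Rightarrow> int" where
  "signed_squares us = (\<Sum>(s, u) \<leftarrow> us. s * u\<^sup>2)"

lemma signed_squares_simps [simp]:
  "signed_squares [] = 0"
  "signed_squares ((s, u) # us) = s * u\<^sup>2 + signed_squares us"
  by (auto simp: signed_squares_def)

text \<open>The multiples of 24 cost four unit squares, because \<open>12 * y = (y + 3)\<^sup>2 - (y - 3)\<^sup>2\<close> and
  \<open>24 * t = 12 * y + 12 * (2 * t - y)\<close>, where \<open>y\<close> only has to avoid at most four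
  residues modulo each prime divisor of \<open>n\<close>; the remainder is a sum of ones.\<close>

lemma signed_sum_of_27_unit_squares:
  assumes n: "(n::nat) > 0"
  shows "\<exists>us. length us \<le> 27 \<and> (\<forall>(s, u) \<in> set us. s \<in> {1, -1} \<and> coprime u (int n)) \<and>
           signed_squares us = t"
proof -
  define P where "P q y \<longleftrightarrow> \<not> int q dvd y + 3 \<and> \<not> int q dvd y - 3 \<and>
           \<not> int q dvd 2 * (t div 24) - y + 3 \<and> \<not> int q dvd 2 * (t div 24) - y - 3" for q y
  have "\<exists>y. \<forall>q. prime q \<longrightarrow> q dvd n \<longrightarrow> P q y"
  proof (rule crt_prime_divisors [OF n])
    show "\<exists>y. P q y" if "prime q" for q
      unfolding P_def by (rule avoid_four_residues [OF that])
    show "P q z" if yz: "[y = z] (mod int q)" and "P q y" for q y z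
    proof -
      have "[y + 3 = z + 3] (mod int q)" "[y - 3 = z - 3] (mod int q)"
        "[2 * (t div 24) - y + 3 = 2 * (t div 24) - z + 3] (mod int q)"
        "[2 * (t div 24) - y - 3 = 2 * (t div 24) - z - 3] (mod int q)"
        using yz by (auto intro!: cong_add cong_diff cong_refl)
      with \<open>P q y\<close> show ?thesis
        unfolding P_def by (simp add: cong_dvd_iff)
    qed
  qed
  then obtain y where y: "\<And>q. prime q \<Longrightarrow> q dvd n \<Longrightarrow> P q y"
    by blast
  let ?x = "2 * (t div 24) - y"
  have cop: "coprime (y + 3) (int n)" "coprime (y - 3) (int n)"
    "coprime (?x + 3) (int n)" "coprime (?x - 3) (int n)"
    using y unfolding P_def by (auto intro!: coprime_if_no_prime_divisor [OF n])
  define us where "us = [(1, y + 3), (-1, y - 3), (1, ?x + 3), (-1, ?x - 3)]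
    @ replicate (nat (t mod 24)) (1::int, 1::int)"
  have ones: "signed_squares (replicate k (1, 1)) = int k" for k
    by (induction k) auto
  have "signed_squares us = 24 * (t div 24) + t mod 24"
    unfolding us_def by (simp add: ones power2_eq_square algebra_simps)
  also have "\<dots> = t"
    by simp
  finally have "signed_squares us = t" .
  \<comment> \<open>The remainder modulo 24 gives at most 23 ones; with the four squares for the
    multiple of 24 this makes 27.\<close>
  moreover have "nat (t mod 24) \<le> 23"
    using pos_mod_bound [of 24 t] by linarith
  then have "length us \<le> 27"
    unfolding us_def by simp
  moreover have "\<forall>(s, u) \<in> set us. s \<in> {1, -1} \<and> coprime u (int n)"
    unfolding us_def using cop by auto
  ultimately show ?thesis
    by blast
qed

text \<open>One row addition with this coefficient collects in a single entry what has to be known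
  about the common prime divisors of two entries.\<close>

lemma stable_range_prime_divisors:
  assumes n: "(n::nat) > 0"
  shows "\<exists>t. \<forall>q. prime q \<longrightarrow> q dvd n \<longrightarrow> int q dvd a + t * b \<longrightarrow> int q dvd a \<and> int q dvd b"
proof -
  define Q where "Q q y \<longleftrightarrow> (int q dvd a + y * b \<longrightarrow> int q dvd a \<and> int q dvd b)" for q y
  have "\<exists>t. \<forall>q. prime q \<longrightarrow> q dvd n \<longrightarrow> Q q t"
  proof (rule crt_prime_divisors [OF n])
    show "\<exists>y. Q q y" for q
      unfolding Q_def
      \<comment> \<open>If \<open>q\<close> divides \<open>a\<close>, then dividing
        \<open>a + b\<close> forces it to divide \<open>b\<close>; otherwise the choice 0 makes the
        premise false.\<close>
      by (rule exI [of _ "if int q dvd a then 1 else 0"]) (simp add: dvd_add_right_iff)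
    show "Q q z" if "[y = z] (mod int q)" "Q q y" for q y z
    proof -
      have "[a + y * b = a + z * b] (mod int q)"
        using that(1) by (intro cong_add cong_mult) auto
      with that(2) show ?thesis
        unfolding Q_def by (simp add: cong_dvd_iff)
    qed
  qed
  then show ?thesis
    unfolding Q_def by blast
qed

section \<open>Symplectic operations on vectors\<close>

definition std :: "nat \<Rightarrow> nat \<Rightarrow> int" where
  "std c i = (if i = c then 1 else 0)"

definition half_sign :: "nat \<Rightarrow> nat \<Rightarrow> int" where
  "half_sign m i = (if i < m then 1 else -1)"

text \<open>This is the bilinear form \<open>u^T sigma v\<close>: row \<open>i\<close> of the form
  matrix has its only nonzero entry in column \<open>partner m i\<close>, and that entry is -1 in
  the upper half and 1 in the lower half.\<close>

definition omega :: "nat \<Rightarrow> (nat \<Rightarrow> int) \<Rightarrow> (nat \<Rightarrow> int) \<Rightarrow> int" where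
  "omega m u v = (\<Sum>i<2 * m. - half_sign m i * u i * v (partner m i))"

text \<open>This extends \<open>C_op\<close> to an arbitrary integer coefficient. The product of the
  half signs encodes whether the two rows lie in the same half. If \<open>k\<close> is the partner
  of \<open>j\<close>, the companion would be the same addition once more and is dropped.\<close>

definition transvec :: "nat \<Rightarrow> nat \<Rightarrow> nat \<Rightarrow> int \<Rightarrow> (nat \<Rightarrow> int) \<Rightarrow> nat \<Rightarrow> int" where
  "transvec m j k a v = (\<lambda>i. v i + a * v j * std k i +
     (if k = partner m j then 0
      else - (half_sign m j * half_sign m k * a * v (partner m k))) * std (partner m j) i)"

definition dil :: "nat \<Rightarrow> nat \<Rightarrow> int \<Rightarrow> int \<Rightarrow> (nat \<Rightarrow> int) \<Rightarrow> nat \<Rightarrow> int" where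
  "dil m j \<alpha> \<beta> v = (\<lambda>i. if i = j then \<alpha> * v i else if i = partner m j then \<beta> * v i else v i)"

datatype sop = Trans nat nat int | Dil nat int int

fun act :: "nat \<Rightarrow> sop \<Rightarrow> (nat \<Rightarrow> int) \<Rightarrow> nat \<Rightarrow> int" where
  "act m (Trans j k a) = transvec m j k a"
| "act m (Dil j \<alpha> \<beta>) = dil m j \<alpha> \<beta>"

lemma std_same [simp]: "std c c = 1"
  by (simp add: std_def)

lemma std_other [simp]: "i \<noteq> c \<Longrightarrow> std c i = 0"
  by (simp add: std_def)

lemma partner_eq: "j < 2 * m \<Longrightarrow> partner m j = (if j < m then j + m else j - m)"
  by (auto simp: partner_def mod_if)

lemma partner_less [simp]: "j < 2 * m \<Longrightarrow> partner m j < 2 * m"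
  by (auto simp: partner_eq)

lemma partner_partner [simp]: "j < 2 * m \<Longrightarrow> partner m (partner m j) = j"
  by (auto simp: partner_eq)

lemma partner_neq [simp]: "j < 2 * m \<Longrightarrow> partner m j \<noteq> j" "j < 2 * m \<Longrightarrow> j \<noteq> partner m j"
  by (auto simp: partner_eq)

lemma partner_inject [simp]: "j < 2 * m \<Longrightarrow> k < 2 * m \<Longrightarrow> partner m j = partner m k \<longleftrightarrow> j = k"
  by (metis partner_partner)

lemma partner_swap: "j < 2 * m \<Longrightarrow> k < 2 * m \<Longrightarrow> j = partner m k \<longleftrightarrow> k = partner m j"
  by (metis partner_partner)

lemma half_sign_partner [simp]: "j < 2 * m \<Longrightarrow> half_sign m (partner m j) = - half_sign m j"
  by (auto simp: partner_eq half_sign_def)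

lemma half_sign_square [simp]: "half_sign m j * half_sign m j = 1" "half_sign m j * (half_sign m j * x) = x"
  by (auto simp: half_sign_def)

lemma omega_add_left: "omega m (\<lambda>i. u i + u' i) v = omega m u v + omega m u' v"
  by (simp add: omega_def algebra_simps sum.distrib sum_negf sum_subtractf)

lemma omega_add_right: "omega m u (\<lambda>i. v i + v' i) = omega m u v + omega m u v'"
  by (simp add: omega_def algebra_simps sum.distrib sum_negf sum_subtractf)

lemma omega_scale_left: "omega m (\<lambda>i. c * u i) v = c * omega m u v"
  by (simp add: omega_def sum_distrib_left algebra_simps)

lemma omega_scale_right: "omega m u (\<lambda>i. c * v i) = c * omega m u v"
  by (simp add: omega_def sum_distrib_left algebra_simps)

lemma omega_std_left: "k < 2 * m \<Longrightarrow> omega m (std k) v = - half_sign m k * v (partner m k)"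
  by (simp add: omega_def std_def if_distrib if_distribR cong: if_cong)

lemma omega_std_right:
  assumes "k < 2 * m"
  shows "omega m u (std k) = half_sign m k * u (partner m k)"
proof -
  have "omega m u (std k) = (\<Sum>i<2 * m. if i = partner m k then half_sign m k * u i else 0)"
    unfolding omega_def using assms
    by (intro sum.cong) (auto simp: std_def)
  then show ?thesis
    using assms by simp
qed

text \<open>With the added multiples of \<open>std k\<close> and \<open>std (partner m j)\<close>
  expanded bilinearly, the terms linear in \<open>a\<close> cancel in pairs by the choice of the
  companion sign. The quadratic ones vanish: unit vectors pair to something nonzero only at partner
  rows, and \<open>k\<close> differs from \<open>j\<close>, the partner of
  \<open>partner m j\<close>.\<close>

lemma omega_transvec:
  assumes "j < 2 * m" "k < 2 * m" "j \<noteq> k"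
  shows "omega m (transvec m j k a u) (transvec m j k a v) = omega m u v"
proof -
  have expand: "omega m (\<lambda>i. u i + x * std k i + y * std q i) (\<lambda>i. v i + x' * std k i + y' * std q i)
    = omega m u v
      + x * omega m (std k) v + y * omega m (std q) v + x' * omega m u (std k) + y' * omega m u (std q)
      + x * x' * omega m (std k) (std k) + y * y' * omega m (std q) (std q)
      + x * y' * omega m (std k) (std q) + y * x' * omega m (std q) (std k)" for x y x' y' q
    by (simp add: omega_add_left omega_add_right omega_scale_left omega_scale_right algebra_simps)
  show ?thesis
    unfolding transvec_def expand using assms
    by (cases "k = partner m j"; simp add: omega_std_left omega_std_right)
      (simp_all add: algebra_simps)
qed

section \<open>Operations on vectors modulo \<open>n\<close>\<close>

locale symplectic_mod =
  fixes m n :: nat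
  assumes m_pos: "m > 0" and n_pos: "n > 0"
begin

text \<open>Vectors hold unreduced integers and arbitrary entries from \<open>2 * m\<close> on; this
  relation is equality of the vectors over Z_n that they represent.\<close>

definition veq :: "(nat \<Rightarrow> int) \<Rightarrow> (nat \<Rightarrow> int) \<Rightarrow> bool" (infix \<open>\<simeq>\<close> 50) where
  "u \<simeq> v \<longleftrightarrow> (\<forall>i<2 * m. [u i = v i] (mod int n))"

lemma veq_refl [simp]: "u \<simeq> u"
  by (simp add: veq_def)

lemma veq_trans: "u \<simeq> v \<Longrightarrow> v \<simeq> w \<Longrightarrow> u \<simeq> w"
  unfolding veq_def by (blast intro: cong_trans)

lemma omega_cong: "u \<simeq> u' \<Longrightarrow> v \<simeq> v' \<Longrightarrow> [omega m u v = omega m u' v'] (mod int n)"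
  unfolding omega_def veq_def by (intro cong_sum cong_mult cong_refl) auto

fun valid :: "sop \<Rightarrow> bool" where
  "valid (Trans j k a) \<longleftrightarrow> j < 2 * m \<and> k < 2 * m \<and> j \<noteq> k"
| "valid (Dil j \<alpha> \<beta>) \<longleftrightarrow> j < 2 * m \<and> [\<alpha> * \<beta> = 1] (mod int n)"

fun inverse_op :: "sop \<Rightarrow> sop" where
  "inverse_op (Trans j k a) = Trans j k (- a)"
| "inverse_op (Dil j \<alpha> \<beta>) = Dil j \<beta> \<alpha>"

lemma inverse_op_inverse_op [simp]: "inverse_op (inverse_op s) = s"
  by (cases s) auto

lemma act_cong: "valid s \<Longrightarrow> u \<simeq> v \<Longrightarrow> act m s u \<simeq> act m s v"
  by (cases s) (auto simp: veq_def transvec_def dil_def intro!: cong_add cong_diff cong_mult cong_refl cong_minus_minus_iff [THEN iffD2])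

lemma act_inverse_op:
  assumes "valid s"
  shows "act m s (act m (inverse_op s) v) \<simeq> v"
proof (cases s)
  case (Trans j k a)
  with assms have "j < 2 * m" "k < 2 * m" "j \<noteq> k"
    by auto
  then show ?thesis
    unfolding Trans by (auto simp: veq_def transvec_def std_def partner_swap [of k] algebra_simps)
next
  case (Dil j \<alpha> \<beta>)
  with assms have "[\<alpha> * \<beta> * x = x] (mod int n)" "[\<beta> * \<alpha> * x = x] (mod int n)" for x
    using cong_mult [of "\<alpha> * \<beta>" 1 "int n" x x] by (auto simp: mult.commute)
  then show ?thesis
    unfolding Dil by (auto simp: veq_def dil_def mult.assoc)
qed

lemma omega_act:
  assumes "valid s"
  shows "[omega m (act m s u) (act m s v) = omega m u v] (mod int n)"
proof (cases s)
  case (Trans j k a)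
  then show ?thesis
    using assms by (simp add: omega_transvec)
next
  case (Dil j \<alpha> \<beta>)
  with assms have ab: "j < 2 * m" "[\<alpha> * \<beta> = 1] (mod int n)"
    by auto
  have *: "[x * (\<alpha> * y) * (\<beta> * z) = x * y * z] (mod int n)" for x y z
    using cong_mult [OF ab(2) cong_refl [of "x * y * z"]] by (simp add: ac_simps)
  have **: "[x * (\<beta> * y) * (\<alpha> * z) = x * y * z] (mod int n)" for x y z
    using cong_mult [OF ab(2) cong_refl [of "x * y * z"]] by (simp add: ac_simps)
  show ?thesis
    unfolding Dil omega_def act.simps
  proof (rule cong_sum)
    fix i assume "i \<in> {..<2 * m}"
    then have i: "i < 2 * m"
      by simp
    show "[- half_sign m i * dil m j \<alpha> \<beta> u i * dil m j \<alpha> \<beta> v (partner m i)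
      = - half_sign m i * u i * v (partner m i)] (mod int n)"
      using i ab(1) * [of "- half_sign m i"] ** [of "- half_sign m i"]
      by (auto simp: dil_def partner_swap [of _ _ j])
  qed
qed

lemma transvec_fixed: "u j = 0 \<Longrightarrow> u (partner m k) = 0 \<Longrightarrow> transvec m j k a u = u"
  by (auto simp: transvec_def)

lemma dil_fixed: "u j = 0 \<Longrightarrow> u (partner m j) = 0 \<Longrightarrow> dil m j \<alpha> \<beta> u = u"
  by (auto simp: dil_def)

definition acts :: "sop list \<Rightarrow> (nat \<Rightarrow> int) \<Rightarrow> nat \<Rightarrow> int" where
  "acts ss = fold (act m) ss"

lemma acts_simps [simp]:
  "acts [] v = v" "acts (s # ss) v = acts ss (act m s v)" "acts (ss @ ts) v = acts ts (acts ss v)"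
  by (simp_all add: acts_def)

lemma acts_cong: "\<forall>s\<in>set ss. valid s \<Longrightarrow> u \<simeq> v \<Longrightarrow> acts ss u \<simeq> acts ss v"
  by (induction ss arbitrary: u v) (auto simp: act_cong)

lemma omega_acts:
  "\<forall>s\<in>set ss. valid s \<Longrightarrow> [omega m (acts ss u) (acts ss v) = omega m u v] (mod int n)"
proof (induction ss arbitrary: u v)
  case (Cons s ss)
  then show ?case
    using omega_act by (fastforce intro: cong_trans)
qed simp

lemma acts_fixed: "\<forall>s\<in>set ss. act m s u = u \<Longrightarrow> acts ss u = u"
  by (induction ss) auto

section \<open>Column reduction\<close>

text \<open>Row \<open>j\<close> has entry 1, so adding \<open>- v k\<close> times it clears row
  \<open>k\<close>. The companion addition writes only to \<open>partner m j\<close>, so entries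
  already cleared stay cleared and that one entry is left for the end.\<close>

lemma clear_list:
  assumes j: "j < 2 * m" and v: "[v j = 1] (mod int n)"
    and ks: "distinct ks" "set ks \<subseteq> {..<2 * m} - {j, partner m j}"
  shows "\<exists>ss. length ss = length ks \<and> set ss \<subseteq> {Trans j k a |k a. k \<in> set ks} \<and>
    (\<forall>i\<in>set ks. [acts ss v i = 0] (mod int n)) \<and>
    (\<forall>i. i \<notin> set ks \<union> {partner m j} \<longrightarrow> acts ss v i = v i)"
  using v ks
proof (induction ks arbitrary: v)
  case Nil
  then show ?case
    by (intro exI [of _ "[]"]) simp
next
  case (Cons k ks)
  define v' where "v' = transvec m j k (- v k) v"
  have k: "k < 2 * m" "k \<noteq> j" "k \<noteq> partner m j" "k \<notin> set ks"
    using Cons.prems by auto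
  have v'_other: "v' i = v i" if "i \<noteq> k" "i \<noteq> partner m j" for i
    using that by (simp add: v'_def transvec_def)
  have "v' k = v k - v k * v j"
    using k by (simp add: v'_def transvec_def)
  also have "[v k - v k * v j = v k - v k * 1] (mod int n)"
    using Cons.prems(1) by (intro cong_diff cong_mult cong_refl)
  finally have v'_k: "[v' k = 0] (mod int n)"
    by simp
  have "v' j = v j"
    using v'_other [of j] k j by simp
  with Cons.prems have "[v' j = 1] (mod int n)" "distinct ks" "set ks \<subseteq> {..<2 * m} - {j, partner m j}"
    by auto
  from Cons.IH [of v', OF this] obtain ss where ss: "length ss = length ks"
    "set ss \<subseteq> {Trans j k a |k a. k \<in> set ks}"
    "\<forall>i\<in>set ks. [acts ss v' i = 0] (mod int n)"
    "\<forall>i. i \<notin> set ks \<union> {partner m j} \<longrightarrow> acts ss v' i = v' i"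
    by blast
  show ?case
    using ss k v'_k v'_other
    by (intro exI [of _ "Trans j k (- v k) # ss"]) (auto simp: v'_def [symmetric])
qed

text \<open>The entry at \<open>partner m j\<close> comes last because the earlier steps may disturb
  it; the addition that clears it has no companion.\<close>

lemma clear_column:
  assumes j: "j < 2 * m" and v: "[v j = 1] (mod int n)"
    and ks: "distinct ks" "set ks \<subseteq> {..<2 * m} - {j, partner m j}"
  shows "\<exists>ss. length ss = Suc (length ks) \<and>
    set ss \<subseteq> {Trans j k a |k a. k \<in> insert (partner m j) (set ks)} \<and>
    (\<forall>i\<in>insert (partner m j) (set ks). [acts ss v i = 0] (mod int n)) \<and>
    (\<forall>i. i \<notin> insert (partner m j) (set ks) \<longrightarrow> acts ss v i = v i)"
proof -
  obtain ss where ss: "length ss = length ks" "set ss \<subseteq> {Trans j k a |k a. k \<in> set ks}"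
    "\<forall>i\<in>set ks. [acts ss v i = 0] (mod int n)"
    "\<forall>i. i \<notin> set ks \<union> {partner m j} \<longrightarrow> acts ss v i = v i"
    using clear_list [where v = v and j = j, OF j v ks] by blast
  define w where "w = acts ss v"
  define a where "a = - w (partner m j)"
  have w_j: "w j = v j"
  proof -
    have "j \<notin> set ks"
      using ks by auto
    with ss(4) j show ?thesis
      by (simp add: w_def)
  qed
  have last_other: "transvec m j (partner m j) a w i = w i" if "i \<noteq> partner m j" for i
    using that by (simp add: transvec_def)
  have "transvec m j (partner m j) a w (partner m j) = w (partner m j) - w (partner m j) * v j"
    by (simp add: transvec_def a_def w_j)
  also have "[\<dots> = w (partner m j) - w (partner m j) * 1] (mod int n)"
    using v by (intro cong_diff cong_mult cong_refl)
  finally have "[transvec m j (partner m j) a w (partner m j) = 0] (mod int n)"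
    by simp
  moreover have "transvec m j (partner m j) a w i = w i" if "i \<in> set ks" for i
    using that ks last_other by blast
  ultimately show ?thesis
    using ss last_other
    by (intro exI [of _ "ss @ [Trans j (partner m j) a]"]) (auto simp: w_def [symmetric])
qed

text \<open>Each step folds row \<open>k\<close> into row \<open>j\<close> with a stable range
  coefficient. Its companion adds a multiple of the entry at \<open>partner m j\<close> to row
  \<open>partner m k\<close>, which is invisible modulo a prime dividing that entry. So only such
  primes are tracked, and the entry at \<open>partner m j\<close> itself has to stay intact.\<close>

lemma gather_list:
  assumes j: "j < 2 * m"
    and ks: "set ks \<subseteq> {..<2 * m} - {j, partner m j}"
  shows "\<exists>ss. length ss = length ks \<and> set ss \<subseteq> {Trans k j a |k a. k \<in> set ks} \<and>
    acts ss v (partner m j) = v (partner m j) \<and>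
    (\<forall>q. prime q \<longrightarrow> q dvd n \<longrightarrow> int q dvd v (partner m j) \<longrightarrow> int q dvd acts ss v j \<longrightarrow>
      (\<forall>k\<in>insert j (set ks). int q dvd v k))"
  using ks
proof (induction ks arbitrary: v)
  case Nil
  then show ?case
    by (intro exI [of _ "[]"]) simp
next
  case (Cons k ks)
  have k: "k < 2 * m" "k \<noteq> j" "k \<noteq> partner m j"
    using Cons.prems by auto
  obtain t where t: "\<And>q. prime q \<Longrightarrow> q dvd n \<Longrightarrow> int q dvd v j + t * v k \<Longrightarrow> int q dvd v j \<and> int q dvd v k"
    using stable_range_prime_divisors [OF n_pos] by blast
  define v' where "v' = transvec m k j t v"
  have neq: "j \<noteq> partner m k"
    using k j partner_swap by metis
  have v'_j: "v' j = v j + t * v k"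
    using k j neq by (simp add: v'_def transvec_def)
  have v'_pj: "v' (partner m j) = v (partner m j)"
    using k j neq by (simp add: v'_def transvec_def)
  have v'_dvd: "int q dvd v i" if "int q dvd v (partner m j)" "i \<noteq> j" "int q dvd v' i" for q i
  proof -
    have "v' i = v i + - (half_sign m k * half_sign m j * t * std (partner m k) i) * v (partner m j)"
      using that(2) neq by (simp add: v'_def transvec_def)
    with that show ?thesis
      by (metis dvd_add_left_iff dvd_mult)
  qed
  have "set ks \<subseteq> {..<2 * m} - {j, partner m j}"
    using Cons.prems by auto
  from Cons.IH [OF this, of v'] obtain ss where ss: "length ss = length ks"
    "set ss \<subseteq> {Trans k j a |k a. k \<in> set ks}"
    "acts ss v' (partner m j) = v' (partner m j)"
    "\<And>q. prime q \<Longrightarrow> q dvd n \<Longrightarrow> int q dvd v' (partner m j) \<Longrightarrow> int q dvd acts ss v' j \<Longrightarrow>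
      \<forall>k\<in>insert j (set ks). int q dvd v' k"
    by blast
  have "\<forall>l\<in>insert j (set (k # ks)). int q dvd v l"
    if q: "prime q" "q dvd n" "int q dvd v (partner m j)" "int q dvd acts ss v' j" for q
  proof -
    have *: "\<forall>k\<in>insert j (set ks). int q dvd v' k"
      using ss(4) q v'_pj by metis
    then have "int q dvd v j \<and> int q dvd v k"
      using t [OF q(1,2)] by (simp add: v'_j)
    moreover have "int q dvd v l" if "l \<in> set ks" for l
      using * that v'_dvd [OF q(3), of l] Cons.prems by auto
    ultimately show ?thesis
      by auto
  qed
  then show ?case
    using ss v'_pj
    by (intro exI [of _ "Trans k j t # ss"]) (auto simp: v'_def [symmetric])
qed

text \<open>The row \<open>partner m j\<close> is folded in last: a prime dividing the resulting
  entry divides both entries involved, so it is one of the primes tracked by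
  \<open>gather_list\<close> and would divide the whole column.\<close>

lemma gather_unit:
  assumes j: "j < 2 * m"
    and ks: "set ks \<subseteq> {..<2 * m} - {j, partner m j}"
    and unimodular: "\<And>q. prime q \<Longrightarrow> q dvd n \<Longrightarrow>
      \<exists>k\<in>insert j (insert (partner m j) (set ks)). \<not> int q dvd v k"
  shows "\<exists>ss. length ss = Suc (length ks) \<and>
    set ss \<subseteq> {Trans k j a |k a. k \<in> insert (partner m j) (set ks)} \<and>
    coprime (acts ss v j) (int n)"
proof -
  obtain ss where ss: "length ss = length ks" "set ss \<subseteq> {Trans k j a |k a. k \<in> set ks}"
    "acts ss v (partner m j) = v (partner m j)"
    "\<And>q. prime q \<Longrightarrow> q dvd n \<Longrightarrow> int q dvd v (partner m j) \<Longrightarrow> int q dvd acts ss v j \<Longrightarrow>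
      (\<forall>k\<in>insert j (set ks). int q dvd v k)"
    using gather_list [OF j ks] by blast
  obtain t where t: "\<And>q. prime q \<Longrightarrow> q dvd n \<Longrightarrow> int q dvd acts ss v j + t * v (partner m j) \<Longrightarrow>
      int q dvd acts ss v j \<and> int q dvd v (partner m j)"
    using stable_range_prime_divisors [OF n_pos] by blast
  have "transvec m (partner m j) j t (acts ss v) j = acts ss v j + t * v (partner m j)"
    using j ss(3) by (simp add: transvec_def)
  moreover have "coprime (acts ss v j + t * v (partner m j)) (int n)"
    using unimodular t ss(4)
    by (intro coprime_if_no_prime_divisor [OF n_pos]) blast
  ultimately show ?thesis
    using ss by (intro exI [of _ "ss @ [Trans (partner m j) j t]"]) auto
qed

text \<open>\<open>A\<close> consists of the rows still to be treated, and \<open>x\<close>,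
  \<open>y\<close> are the columns \<open>j\<close> and \<open>partner m j\<close>. Operations
  confined to \<open>A\<close> fix the unit vectors outside \<open>A\<close>, so columns already
  reduced survive. Creating a unit and the two clearings cost \<open>card A - 1\<close> each and the
  dilation costs 1, which stays below \<open>3 * card A\<close>.\<close>

lemma reduce_pair:
  assumes A: "A \<subseteq> {..<2 * m}" "partner m ` A \<subseteq> A" and j: "j \<in> A"
    and x0: "\<And>i. i < 2 * m \<Longrightarrow> i \<notin> A \<Longrightarrow> [x i = 0] (mod int n)"
    and y0: "\<And>i. i < 2 * m \<Longrightarrow> i \<notin> A \<Longrightarrow> [y i = 0] (mod int n)"
    and xy: "[omega m x y = omega m (std j) (std (partner m j))] (mod int n)"
  shows "\<exists>ss. length ss \<le> 3 * card A \<and> (\<forall>s\<in>set ss. valid s) \<and>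
    (\<forall>s\<in>set ss. \<forall>c. c < 2 * m \<longrightarrow> c \<notin> A \<longrightarrow> act m s (std c) = std c) \<and>
    acts ss x \<simeq> std j \<and> acts ss y \<simeq> std (partner m j)"
proof -
  let ?p = "partner m"
  have jd: "j < 2 * m" and pj: "?p j \<in> A"
    using A j by auto
  have fin: "finite A"
    using A(1) finite_subset by blast
  obtain ks where ks: "set ks = A - {j, ?p j}" "distinct ks"
    using finite_distinct_list fin by blast
  have card: "length ks + 2 = card A"
  proof -
    have "length ks = card (A - {j, ?p j})"
      using ks distinct_card by metis
    also have "\<dots> = card A - card {j, ?p j}"
      using j pj by (intro card_Diff_subset) auto
    also have "card {j, ?p j} = 2"
      using jd by simp
    finally show ?thesis
      using card_mono [OF fin, of "{j, ?p j}"] j pj jd by simp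
  qed
  have ks_sub: "set ks \<subseteq> {..<2 * m} - {j, ?p j}"
    using ks A by auto
  have not_ks: "j \<notin> set ks" "?p j \<notin> set ks"
    using ks by auto
  have A_eq: "insert j (insert (?p j) (set ks)) = A"
    using ks j pj by auto
  have om: "[omega m x y = - half_sign m j] (mod int n)"
    using xy jd by (simp add: omega_std_left)

  \<comment> \<open>A prime dividing all entries of \<open>x\<close> would divide the value of the
    form on \<open>x\<close> and \<open>y\<close>, which is 1 or -1 modulo that prime.\<close>
  have unimodular: "\<exists>k\<in>insert j (insert (?p j) (set ks)). \<not> int q dvd x k" if q: "prime q" "q dvd n" for q
  proof (rule ccontr)
    assume "\<not> ?thesis"
    then have "int q dvd x i" if "i < 2 * m" for i
      using that x0 [of i] q A_eq by (metis cong_0_iff dvd_trans int_dvd_int_iff)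
    then have "int q dvd omega m x y"
      unfolding omega_def by (intro dvd_sum) auto
    moreover have "[omega m x y = - half_sign m j] (mod int q)"
      using om q by (meson cong_dvd_modulus int_dvd_int_iff)
    ultimately have "int q dvd - half_sign m j"
      using cong_dvd_iff by blast
    then have "int q dvd 1"
      by (auto simp: half_sign_def split: if_splits)
    with q show False
      by auto
  qed
  obtain s1 where s1: "length s1 = Suc (length ks)"
    "set s1 \<subseteq> {Trans k j a |k a. k \<in> insert (?p j) (set ks)}"
    "coprime (acts s1 x j) (int n)"
    using gather_unit [OF jd ks_sub unimodular] by blast
  obtain b where b: "[acts s1 x j * b = 1] (mod int n)"
    using s1(3) cong_solve_coprime_int by blast
  \<comment> \<open>The entry itself is inverse to \<open>b\<close> modulo \<open>n\<close>, so it
    serves as the factor for the partner row.\<close>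
  define s2 where "s2 = s1 @ [Dil j b (acts s1 x j)]"
  have x2: "[acts s2 x j = 1] (mod int n)"
    using b by (simp add: s2_def dil_def mult.commute)
  obtain s3 where s3: "length s3 = Suc (length ks)"
    "set s3 \<subseteq> {Trans j k a |k a. k \<in> insert (?p j) (set ks)}"
    "\<forall>i\<in>insert (?p j) (set ks). [acts s3 (acts s2 x) i = 0] (mod int n)"
    "\<forall>i. i \<notin> insert (?p j) (set ks) \<longrightarrow> acts s3 (acts s2 x) i = acts s2 x i"
    using clear_column [where v = "acts s2 x" and j = j, OF jd x2 ks(2) ks_sub] by blast
  define s4 where "s4 = s2 @ s3"

  have valid_Trans: "valid (Trans k j a) \<and> valid (Trans j k a)" if "k \<in> insert (?p j) (set ks)" for k a
    using that jd ks_sub by auto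
  have valid4: "\<forall>s\<in>set s4. valid s"
  proof -
    have "valid (Dil j b (acts s1 x j))"
      using b jd by (simp add: mult.commute)
    moreover have "\<forall>s\<in>set s1 \<union> set s3. valid s"
      using s1(2) s3(2) valid_Trans by blast
    ultimately show ?thesis
      by (auto simp: s4_def s2_def)
  qed
  have fixed4: "act m s (std c) = std c" if s: "s \<in> set s4" and c: "c < 2 * m" "c \<notin> A" for s c
  proof -
    have zero: "std c i = 0" if "i \<in> A" for i
      using that c by (metis std_other)
    have kA: "k \<in> A \<and> ?p k \<in> A" if "k \<in> insert (?p j) (set ks)" for k
      using that A_eq A(2) by auto
    consider "s = Dil j b (acts s1 x j)"
      | k a where "s = Trans k j a \<or> s = Trans j k a" "k \<in> insert (?p j) (set ks)"
    proof -
      have "s = Dil j b (acts s1 x j) \<or> s \<in> set s1 \<or> s \<in> set s3"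
        using s by (auto simp: s4_def s2_def)
      then show ?thesis
        using that s1(2) s3(2) by blast
    qed
    then show ?thesis
    proof cases
      case 1
      then show ?thesis
        using zero j pj by (simp add: dil_fixed)
    next
      case 2
      then show ?thesis
        using zero kA j pj by (auto intro!: transvec_fixed)
    qed
  qed
  \<comment> \<open>Pairing with the unit vector at \<open>partner m i\<close>, which the operations
    fix, reads off entry \<open>i\<close> up to sign; so preservation of the form forbids a change
    there modulo \<open>n\<close>.\<close>
  have outside: "[acts s4 u i = 0] (mod int n)"
    if i: "i < 2 * m" "i \<notin> A" and u: "\<And>i. i < 2 * m \<Longrightarrow> i \<notin> A \<Longrightarrow> [u i = 0] (mod int n)" for u i
  proof -
    have "[omega m (acts s4 u) (acts s4 (std (?p i))) = omega m u (std (?p i))] (mod int n)"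
      using omega_acts [OF valid4] .
    moreover have "?p i \<notin> A"
      using A i by (metis image_subset_iff partner_partner)
    then have "acts s4 (std (?p i)) = std (?p i)"
      using fixed4 i by (intro acts_fixed) auto
    ultimately have "[- half_sign m i * acts s4 u i = - half_sign m i * u i] (mod int n)"
      using i by (simp add: omega_std_right)
    then have "[acts s4 u i = u i] (mod int n)"
      by (auto simp: half_sign_def cong_minus_minus_iff split: if_splits)
    then show ?thesis
      using u [OF i] cong_trans by blast
  qed
  have x4: "acts s4 x \<simeq> std j"
    unfolding veq_def
  proof (intro allI impI)
    fix i assume i: "i < 2 * m"
    consider "i = j" | "i \<in> insert (?p j) (set ks)" "i \<noteq> j" | "i \<notin> A"
      using A_eq by blast
    then show "[acts s4 x i = std j i] (mod int n)"
    proof cases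
      case 1
      then show ?thesis
        using s3(4) x2 not_ks jd by (simp add: s4_def)
    next
      case 2
      then show ?thesis
        using s3(3) by (auto simp: s4_def)
    next
      case 3
      then show ?thesis
        using outside [OF i _ x0] j by (auto simp: std_def)
    qed
  qed
  \<comment> \<open>As \<open>x\<close> is now \<open>std j\<close>, the preserved value of the form
    is the entry of \<open>y\<close> at \<open>partner m j\<close> up to a sign present on both
    sides.\<close>
  have y4: "[acts s4 y (?p j) = 1] (mod int n)"
  proof -
    have "[omega m (acts s4 x) (acts s4 y) = omega m (std j) (acts s4 y)] (mod int n)"
      using omega_cong x4 veq_refl by blast
    moreover have "[omega m (acts s4 x) (acts s4 y) = omega m x y] (mod int n)"
      using omega_acts [OF valid4] .
    ultimately have "[omega m (std j) (acts s4 y) = - half_sign m j] (mod int n)"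
      using om by (meson cong_sym cong_trans)
    then have "[- half_sign m j * acts s4 y (?p j) = - half_sign m j] (mod int n)"
      using jd by (simp add: omega_std_left)
    then show ?thesis
      by (auto simp: half_sign_def cong_minus_minus_iff [of _ 1] split: if_splits)
  qed
  have pjd: "?p j < 2 * m" and ks_sub': "set ks \<subseteq> {..<2 * m} - {?p j, ?p (?p j)}"
    using jd ks_sub by auto
  obtain s5 where s5: "length s5 = Suc (length ks)"
    "set s5 \<subseteq> {Trans (?p j) k a |k a. k \<in> insert j (set ks)}"
    "\<forall>i\<in>insert j (set ks). [acts s5 (acts s4 y) i = 0] (mod int n)"
    "\<forall>i. i \<notin> insert j (set ks) \<longrightarrow> acts s5 (acts s4 y) i = acts s4 y i"
    using clear_column [where v = "acts s4 y" and j = "?p j", OF pjd y4 ks(2) ks_sub'] jd by auto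
  have valid5: "\<forall>s\<in>set s5. valid s"
  proof -
    have "valid (Trans (?p j) k a)" if "k \<in> insert j (set ks)" for k a
      using that ks_sub' pjd jd by auto
    with s5(2) show ?thesis
      by blast
  qed
  \<comment> \<open>These operations read the rows \<open>partner m j\<close> and
    \<open>partner m k\<close> with \<open>k\<close> other than \<open>partner m j\<close>. Both
    entries are 0 in \<open>std j\<close>, so clearing \<open>y\<close> does not undo the reduction
    of \<open>x\<close>.\<close>
  have fixed5: "act m s (std c) = std c" if s: "s \<in> set s5" and c: "c \<noteq> ?p j" "c < 2 * m" "c = j \<or> c \<notin> A" for s c
  proof -
    obtain k a where k: "s = Trans (?p j) k a" "k \<in> insert j (set ks)"
      using s s5(2) by auto
    have "k \<in> A" "?p k \<noteq> j"
      using k(2) A_eq ks(1) jd ks_sub partner_swap [of j m k] by auto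
    then have "c \<noteq> ?p k"
      using c A(2) by auto
    then show ?thesis
      using k c by (auto intro!: transvec_fixed)
  qed
  have x5: "acts (s4 @ s5) x \<simeq> std j"
  proof -
    have "acts s5 (acts s4 x) \<simeq> acts s5 (std j)"
      using acts_cong valid5 x4 by blast
    moreover have "acts s5 (std j) = std j"
      using fixed5 jd by (intro acts_fixed) auto
    ultimately show ?thesis
      by simp
  qed
  have y5: "acts (s4 @ s5) y \<simeq> std (?p j)"
    unfolding veq_def
  proof (intro allI impI)
    fix i assume i: "i < 2 * m"
    consider "i = ?p j" | "i \<in> insert j (set ks)" "i \<noteq> ?p j" | "i \<notin> A"
      using A_eq by blast
    then show "[acts (s4 @ s5) y i = std (?p j) i] (mod int n)"
    proof cases
      case 1
      then show ?thesis
        using s5(4) y4 not_ks jd by simp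
    next
      case 2
      then show ?thesis
        using s5(3) by auto
    next
      case 3
      then have "i \<notin> insert j (set ks)" "i \<noteq> ?p j"
        using A_eq by auto
      then show ?thesis
        using outside [OF i 3 y0] s5(4) by simp
    qed
  qed
  have "length (s4 @ s5) \<le> 3 * card A"
    using card s1(1) s3(1) s5(1) by (simp add: s4_def s2_def)
  moreover have "\<forall>s\<in>set (s4 @ s5). \<forall>c. c < 2 * m \<longrightarrow> c \<notin> A \<longrightarrow> act m s (std c) = std c"
    using fixed4 fixed5 pj by (metis Un_iff set_append)
  ultimately show ?thesis
    using x5 y5 valid4 valid5 by (intro exI [of _ "s4 @ s5"]) auto
qed

section \<open>Induction over pairs of columns\<close>

definition symplectic_columns :: "(nat \<Rightarrow> nat \<Rightarrow> int) \<Rightarrow> bool" where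
  "symplectic_columns F \<longleftrightarrow> (\<forall>c<2 * m. \<forall>c'<2 * m.
     [omega m (F c) (F c') = omega m (std c) (std c')] (mod int n))"

lemma symplectic_columns_acts:
  assumes "symplectic_columns F" "\<forall>s\<in>set ss. valid s"
  shows "symplectic_columns (\<lambda>c. acts ss (F c))"
  using assms omega_acts unfolding symplectic_columns_def by (blast intro: cong_trans)

text \<open>\<open>A\<close> is the set of columns not yet reduced, and it loses a pair
  \<open>j\<close>, \<open>partner m j\<close> at each step. One step costs at most
  \<open>3 * card A\<close>, hence at most \<open>6 * m\<close>, and this is what the bound drops
  by.\<close>

lemma reduce_to_standard:
  assumes "A \<subseteq> {..<2 * m}" "partner m ` A \<subseteq> A" "symplectic_columns F"
    and "\<And>c. c < 2 * m \<Longrightarrow> c \<notin> A \<Longrightarrow> F c \<simeq> std c"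
  shows "\<exists>ss. length ss \<le> 3 * m * card A \<and> (\<forall>s\<in>set ss. valid s) \<and>
    (\<forall>c<2 * m. acts ss (F c) \<simeq> std c)"
  using assms
proof (induction "card A" arbitrary: A F rule: less_induct)
  case less
  let ?p = "partner m"
  have fin: "finite A"
    using less.prems(1) finite_subset by blast
  show ?case
  proof (cases "A = {}")
    case True
    then show ?thesis
      using less.prems by (intro exI [of _ "[]"]) auto
  next
    case False
    then obtain j where j: "j \<in> A"
      by blast
    then have jd: "j < 2 * m" and pj: "?p j \<in> A"
      using less.prems by auto
    \<comment> \<open>For \<open>i\<close> outside \<open>A\<close>, column
      \<open>partner m i\<close> is already a unit vector; its form value with column
      \<open>c\<close> is \<open>F c i\<close> up to sign and must be 0.\<close>
    have zero: "[F c i = 0] (mod int n)" if c: "c \<in> A" and i: "i < 2 * m" "i \<notin> A" for c i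
    proof -
      have pi: "?p i < 2 * m" "?p i \<notin> A" and cd: "c < 2 * m"
      proof -
        show "?p i \<notin> A"
          using i less.prems(2) by (metis image_subset_iff partner_partner)
      qed (use i c less.prems(1) in auto)
      have "[omega m (F c) (F (?p i)) = omega m (F c) (std (?p i))] (mod int n)"
        using omega_cong less.prems(4) pi veq_refl by blast
      moreover have "[omega m (F c) (F (?p i)) = omega m (std c) (std (?p i))] (mod int n)"
        using less.prems(3) pi cd by (simp add: symplectic_columns_def)
      ultimately have "[omega m (F c) (std (?p i)) = omega m (std c) (std (?p i))] (mod int n)"
        by (meson cong_sym cong_trans)
      moreover have "std c i = 0"
        using c i by (metis std_other)
      ultimately have "[- half_sign m i * F c i = 0] (mod int n)"
        using i by (simp add: omega_std_right)
      then show ?thesis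
        by (auto simp: half_sign_def cong_0_iff split: if_splits)
    qed
    have "[omega m (F j) (F (?p j)) = omega m (std j) (std (?p j))] (mod int n)"
      using less.prems(3) jd by (simp add: symplectic_columns_def)
    from reduce_pair [OF less.prems(1,2) j zero [OF j] zero [OF pj] this]
    obtain s1 where s1: "length s1 \<le> 3 * card A" "\<forall>s\<in>set s1. valid s"
      "\<forall>s\<in>set s1. \<forall>c. c < 2 * m \<longrightarrow> c \<notin> A \<longrightarrow> act m s (std c) = std c"
      "acts s1 (F j) \<simeq> std j" "acts s1 (F (?p j)) \<simeq> std (?p j)"
      by blast
    define A' where "A' = A - {j, ?p j}"
    have "card A' = card A - card {j, ?p j}"
      unfolding A'_def using j pj by (intro card_Diff_subset) auto
    moreover have "card {j, ?p j} = 2"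
      using jd by simp
    moreover have "card {j, ?p j} \<le> card A"
      using fin j pj by (intro card_mono) auto
    ultimately have card: "card A' + 2 = card A"
      by linarith
    have "acts s1 (F c) \<simeq> std c" if c: "c < 2 * m" "c \<notin> A'" for c
    proof -
      consider "c = j" | "c = ?p j" | "c \<notin> A"
        using c by (auto simp: A'_def)
      then show ?thesis
      proof cases
        case 3
        then have "acts s1 (F c) \<simeq> acts s1 (std c)"
          using acts_cong s1(2) less.prems(4) c by blast
        moreover have "acts s1 (std c) = std c"
          using s1(3) c 3 by (intro acts_fixed) auto
        ultimately show ?thesis
          by simp
      qed (use s1 in auto)
    qed
    moreover have "?p ` A' \<subseteq> A'"
    proof -
      have "?p k \<in> A'" if "k \<in> A'" for k
        using that less.prems(1,2) jd partner_swap [of k m j] by (auto simp: A'_def)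
      then show ?thesis
        by blast
    qed
    moreover have "A' \<subseteq> {..<2 * m}"
      using less.prems(1) by (auto simp: A'_def)
    moreover have "card A' < card A"
      using card by simp
    ultimately obtain s2 where s2: "length s2 \<le> 3 * m * card A'" "\<forall>s\<in>set s2. valid s"
      "\<forall>c<2 * m. acts s2 (acts s1 (F c)) \<simeq> std c"
      using less.hyps [of A' "\<lambda>c. acts s1 (F c)"] symplectic_columns_acts [OF less.prems(3) s1(2)]
      by blast
    have "card A \<le> 2 * m"
      using card_mono [OF finite_lessThan less.prems(1)] by simp
    then have "3 * card A + 3 * m * card A' \<le> 3 * m * (card A' + 2)"
      by (simp add: algebra_simps)
    then have "length (s1 @ s2) \<le> 3 * m * card A"
      unfolding card using s1(1) s2(1) by simp
    then show ?thesis
      using s1(2) s2 by (intro exI [of _ "s1 @ s2"]) auto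
  qed
qed

section \<open>Matrices of the row operations\<close>

abbreviation MZ :: "int mat monoid" where
  "MZ \<equiv> Mat_Zn (2 * m) n"

definition col_mat :: "(nat \<Rightarrow> nat \<Rightarrow> int) \<Rightarrow> int mat" where
  "col_mat F = mat (2 * m) (2 * m) (\<lambda>(i, c). F c i mod int n)"

lemma col_mat_cong: "(\<And>c. c < 2 * m \<Longrightarrow> F c \<simeq> G c) \<Longrightarrow> col_mat F = col_mat G"
  unfolding col_mat_def by (auto simp: veq_def cong_def intro!: cong_mat)

lemma col_mat_closed [simp]: "col_mat F \<in> carrier MZ"
  using n_pos by (auto simp: Mat_Zn_def col_mat_def elements_mat_def)

lemma col_mat_index:
  assumes "A \<in> carrier MZ"
  shows "A = col_mat (\<lambda>c i. A $$ (i, c))"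
proof -
  have A: "A \<in> carrier_mat (2 * m) (2 * m)" "elements_mat A \<subseteq> {0..<int n}"
    using assms by (auto simp: Mat_Zn_def)
  have "A $$ (i, c) mod int n = A $$ (i, c)" if "i < 2 * m" "c < 2 * m" for i c
    using A that by (metis atLeastLessThan_iff elements_matI mod_pos_pos_trivial subsetD)
  then show ?thesis
    using A by (intro eq_matI) (auto simp: col_mat_def)
qed

lemma one_MZ: "\<one>\<^bsub>MZ\<^esub> = col_mat std"
  by (intro eq_matI) (auto simp: Mat_Zn_def col_mat_def reduce_mat_def std_def)

lemma mult_MZ: "col_mat F \<otimes>\<^bsub>MZ\<^esub> col_mat G = col_mat (\<lambda>c i. \<Sum>l<2 * m. F l i * G c l)"
proof (intro eq_matI)
  fix i c assume "i < dim_row (col_mat (\<lambda>c i. \<Sum>l<2 * m. F l i * G c l))"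
    "c < dim_col (col_mat (\<lambda>c i. \<Sum>l<2 * m. F l i * G c l))"
  then have ic: "i < 2 * m" "c < 2 * m"
    by (auto simp: col_mat_def)
  have "[\<Sum>l<2 * m. F l i mod int n * (G c l mod int n) = \<Sum>l<2 * m. F l i * G c l] (mod int n)"
    by (intro cong_sum cong_mult) (simp_all add: cong_def)
  then show "(col_mat F \<otimes>\<^bsub>MZ\<^esub> col_mat G) $$ (i, c)
    = col_mat (\<lambda>c i. \<Sum>l<2 * m. F l i * G c l) $$ (i, c)"
    using ic by (simp add: cong_def Mat_Zn_def col_mat_def reduce_mat_def scalar_prod_def atLeast0LessThan)
qed (auto simp: Mat_Zn_def col_mat_def reduce_mat_def)

lemma monoid_MZ: "monoid MZ"
proof (rule monoidI)
  fix A B C assume "A \<in> carrier MZ" "B \<in> carrier MZ" "C \<in> carrier MZ"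
  then obtain F G H where *: "A = col_mat F" "B = col_mat G" "C = col_mat H"
    by (rule that [OF col_mat_index col_mat_index col_mat_index])
  show "A \<otimes>\<^bsub>MZ\<^esub> B \<in> carrier MZ"
    by (simp add: * mult_MZ)
  show "A \<otimes>\<^bsub>MZ\<^esub> B \<otimes>\<^bsub>MZ\<^esub> C = A \<otimes>\<^bsub>MZ\<^esub> (B \<otimes>\<^bsub>MZ\<^esub> C)"
    unfolding * mult_MZ
    by (rule arg_cong [of _ _ col_mat])
      (auto simp: fun_eq_iff sum_distrib_left sum_distrib_right mult.assoc intro: sum.swap)
  show "\<one>\<^bsub>MZ\<^esub> \<otimes>\<^bsub>MZ\<^esub> A = A" "A \<otimes>\<^bsub>MZ\<^esub> \<one>\<^bsub>MZ\<^esub> = A"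
    unfolding * mult_MZ one_MZ
    by (intro col_mat_cong; auto simp: veq_def std_def if_distrib if_distribR cong: if_cong)+
qed (simp add: one_MZ)

section \<open>Linear operators and their matrices\<close>

definition linear_map :: "((nat \<Rightarrow> int) \<Rightarrow> nat \<Rightarrow> int) \<Rightarrow> bool" where
  "linear_map f \<longleftrightarrow> (\<forall>v. \<forall>i<2 * m. f v i = (\<Sum>l<2 * m. f (std l) i * v l))"

definition op_mat :: "((nat \<Rightarrow> int) \<Rightarrow> nat \<Rightarrow> int) \<Rightarrow> int mat" where
  "op_mat f = col_mat (\<lambda>c. f (std c))"

lemma op_mat_closed [simp]: "op_mat f \<in> carrier MZ"
  by (simp add: op_mat_def)

lemma op_mat_mult_cols: "linear_map f \<Longrightarrow> op_mat f \<otimes>\<^bsub>MZ\<^esub> col_mat G = col_mat (\<lambda>c. f (G c))"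
  unfolding op_mat_def mult_MZ
  by (intro col_mat_cong) (auto simp: veq_def linear_map_def)

lemma op_mat_mult: "linear_map f \<Longrightarrow> op_mat f \<otimes>\<^bsub>MZ\<^esub> op_mat g = op_mat (f \<circ> g)"
  by (simp add: op_mat_mult_cols op_mat_def [of g]) (simp add: op_mat_def)

lemma sum_std: "l < 2 * m \<Longrightarrow> (\<Sum>i<2 * m. c * std i l * v i) = c * v l"
  by (simp add: std_def if_distrib if_distribR cong: if_cong)

definition shear :: "nat \<Rightarrow> nat \<Rightarrow> int \<Rightarrow> (nat \<Rightarrow> int) \<Rightarrow> nat \<Rightarrow> int" where
  "shear j k a v = (\<lambda>i. v i + (if i = k then a * v j else 0))"

lemma linear_map_shear: "j < 2 * m \<Longrightarrow> linear_map (shear j k a)"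
  unfolding linear_map_def shear_def
  using sum_std [where c = 1]
  by (auto simp: distrib_right sum.distrib sum_std)

lemma linear_map_dil: "linear_map (dil m j \<alpha> \<beta>)"
  unfolding linear_map_def dil_def using sum_std [where c = 1] by (auto simp: sum_std)

lemma linear_map_compose:
  assumes f: "linear_map f" and g: "linear_map g"
  shows "linear_map (f \<circ> g)"
  unfolding linear_map_def
proof (intro allI impI)
  fix v i assume i: "i < 2 * m"
  have fe: "f w i = (\<Sum>l<2 * m. f (std l) i * w l)" for w
    using f i by (simp add: linear_map_def)
  have ge: "g w l = (\<Sum>k<2 * m. g (std k) l * w k)" if "l < 2 * m" for w l
    using g that by (simp add: linear_map_def)
  have "(f \<circ> g) v i = (\<Sum>l<2 * m. f (std l) i * (\<Sum>k<2 * m. g (std k) l * v k))"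
    unfolding o_def by (subst fe) (auto intro!: sum.cong ge)
  also have "\<dots> = (\<Sum>k<2 * m. (\<Sum>l<2 * m. f (std l) i * g (std k) l) * v k)"
    unfolding sum_distrib_left sum_distrib_right mult.assoc by (rule sum.swap)
  also have "\<dots> = (\<Sum>k<2 * m. (f \<circ> g) (std k) i * v k)"
    by (simp add: fe [symmetric])
  finally show "(f \<circ> g) v i = (\<Sum>k<2 * m. (f \<circ> g) (std k) i * v k)" .
qed

text \<open>Doing the two additions one after the other agrees with the simultaneous update because
  the rows read, \<open>j\<close> and \<open>partner m k\<close>, are not among the rows written,
  \<open>k\<close> and \<open>partner m j\<close>.\<close>

lemma transvec_shear:
  assumes "j < 2 * m" "k < 2 * m" "j \<noteq> k"
  shows "transvec m j k a = (if k = partner m j then shear j k a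
    else shear j k a \<circ> shear (partner m k) (partner m j) (- (half_sign m j * half_sign m k * a)))"
  using assms by (auto simp: fun_eq_iff transvec_def shear_def std_def partner_swap [of _ _ k])

lemma linear_map_transvec: "j < 2 * m \<Longrightarrow> k < 2 * m \<Longrightarrow> j \<noteq> k \<Longrightarrow> linear_map (transvec m j k a)"
  by (simp add: transvec_shear linear_map_shear linear_map_compose)

lemma linear_map_act: "valid s \<Longrightarrow> linear_map (act m s)"
  by (cases s) (auto simp: linear_map_transvec linear_map_dil)

lemma inv_GL:
  assumes "linear_map f" "linear_map g" "\<And>v. f (g v) \<simeq> v" "\<And>v. g (f v) \<simeq> v"
  shows "inv\<^bsub>GL (2 * m) n\<^esub> (op_mat f) = op_mat g"
proof -
  interpret M: monoid MZ
    by (rule monoid_MZ)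
  interpret G: group "GL (2 * m) n"
    unfolding GL_def by (rule M.units_group)
  have "op_mat (f \<circ> g) = col_mat std" "op_mat (g \<circ> f) = col_mat std"
    unfolding op_mat_def by (auto intro!: col_mat_cong simp: assms)
  then have one: "op_mat f \<otimes>\<^bsub>MZ\<^esub> op_mat g = \<one>\<^bsub>MZ\<^esub>" "op_mat g \<otimes>\<^bsub>MZ\<^esub> op_mat f = \<one>\<^bsub>MZ\<^esub>"
    using assms by (simp_all add: op_mat_mult one_MZ)
  then have "op_mat f \<in> Units MZ" "op_mat g \<in> Units MZ"
    by (auto simp: Units_def)
  with one show ?thesis
    by (intro G.inv_equality) (auto simp: GL_def units_of_def)
qed

lemma mult_GL: "A \<otimes>\<^bsub>GL (2 * m) n\<^esub> B = A \<otimes>\<^bsub>MZ\<^esub> B"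
  by (simp add: GL_def units_of_def)

lemma mult_Sp: "A \<otimes>\<^bsub>Sp m n\<^esub> B = A \<otimes>\<^bsub>MZ\<^esub> B"
  by (simp add: Sp_def)

lemma one_Sp: "\<one>\<^bsub>Sp m n\<^esub> = col_mat std"
  by (simp add: Sp_def one_MZ [symmetric])

lemma row_add_op_mat: "j < 2 * m \<Longrightarrow> k < 2 * m \<Longrightarrow> j \<noteq> k \<Longrightarrow> row_add m n j k = op_mat (shear j k 1)"
  by (intro eq_matI)
    (auto simp: row_add_def reduce_mat_def addrow_mat_def op_mat_def col_mat_def shear_def std_def)

lemma shear_inverse: "j \<noteq> k \<Longrightarrow> shear j k a (shear j k (- a) v) \<simeq> v"
  by (auto simp: veq_def shear_def)

lemma inv_shear:
  assumes "j < 2 * m" "k < 2 * m" "j \<noteq> k"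
  shows "inv\<^bsub>GL (2 * m) n\<^esub> (op_mat (shear j k 1)) = op_mat (shear j k (- 1))"
  using assms shear_inverse [of j k 1] shear_inverse [of j k "-1"]
  by (auto simp: linear_map_shear intro!: inv_GL)

lemma are_partners_iff: "j < 2 * m \<Longrightarrow> k < 2 * m \<Longrightarrow> are_partners m j k \<longleftrightarrow> k = partner m j"
proof -
  assume jk: "j < 2 * m" "k < 2 * m"
  have "are_partners m j k \<longleftrightarrow> [int j + int m = int k] (mod int (2 * m))"
  proof -
    have "are_partners m j k \<longleftrightarrow> int (2 * m) dvd (int j - int k - int m)"
      by (simp add: are_partners_def cong_iff_dvd_diff)
    also have "\<dots> \<longleftrightarrow> int (2 * m) dvd (int j + int m - int k)"
      \<comment> \<open>Adding \<open>2 * m\<close> turns \<open>- m\<close> into \<open>m\<close>: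
        half the modulus is its own negative.\<close>
      using dvd_add_left_iff [of "int (2 * m)" "int (2 * m)" "int j - int k - int m"]
      by (simp add: algebra_simps)
    finally show ?thesis
      by (simp add: cong_iff_dvd_diff)
  qed
  also have "\<dots> \<longleftrightarrow> [j + m = k] (mod 2 * m)"
    by (metis cong_int_iff of_nat_add)
  also have "\<dots> \<longleftrightarrow> k = partner m j"
    using jk by (auto simp: cong_def partner_def)
  finally show ?thesis .
qed

text \<open>The companion sign of \<open>transvec\<close> reproduces the case distinction of
  \<open>C_op\<close>: inverse addition for rows in the same half, plain addition for rows in
  different halves.\<close>

lemma C_op_op_mat:
  assumes jk: "j < 2 * m" "k < 2 * m" "j \<noteq> k"
  shows "C_op m n j k = op_mat (transvec m j k 1)"
proof -
  have p: "partner m k < 2 * m" "partner m j < 2 * m" "partner m k \<noteq> partner m j"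
    using jk by auto
  have sign: "half_sign m j * half_sign m k = (if j < m \<longleftrightarrow> k < m then 1 else -1)"
    by (auto simp: half_sign_def)
  show ?thesis
    using jk p
    by (auto simp: C_op_def are_partners_iff mult_GL inv_shear row_add_op_mat op_mat_mult
        linear_map_shear transvec_shear sign)
qed

lemma inv_C_op:
  assumes jk: "j < 2 * m" "k < 2 * m" "j \<noteq> k"
  shows "inv\<^bsub>GL (2 * m) n\<^esub> (C_op m n j k) = op_mat (transvec m j k (- 1))"
proof -
  have "transvec m j k 1 (transvec m j k (- 1) v) \<simeq> v" for v
    using act_inverse_op [of "Trans j k 1" v] jk by simp
  moreover have "transvec m j k (- 1) (transvec m j k 1 v) \<simeq> v" for v
    using act_inverse_op [of "Trans j k (- 1)" v] jk by simp
  ultimately show ?thesis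
    unfolding C_op_op_mat [OF jk] using linear_map_transvec [OF jk] by (intro inv_GL)
qed

section \<open>Dilations as matrices\<close>

lemma monoid_Zn: "monoid (Zn n)"
proof (rule monoidI)
  fix x y z
  show "x \<otimes>\<^bsub>Zn n\<^esub> y \<otimes>\<^bsub>Zn n\<^esub> z = x \<otimes>\<^bsub>Zn n\<^esub> (y \<otimes>\<^bsub>Zn n\<^esub> z)"
    by (simp add: Zn_def mod_mult_left_eq mod_mult_right_eq mult.assoc)
  assume "x \<in> carrier (Zn n)"
  then show "\<one>\<^bsub>Zn n\<^esub> \<otimes>\<^bsub>Zn n\<^esub> x = x" "x \<otimes>\<^bsub>Zn n\<^esub> \<one>\<^bsub>Zn n\<^esub> = x"
    by (simp_all add: Zn_def mod_mult_left_eq mod_mult_right_eq)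
qed (use n_pos in \<open>simp_all add: Zn_def\<close>)

lemma Units_Zn:
  assumes ab: "[\<alpha> * \<beta> = 1] (mod int n)"
  shows "\<alpha> mod int n \<in> Units (Zn n)" "inv\<^bsub>Zn n\<^esub> (\<alpha> mod int n) = \<beta> mod int n"
proof -
  have carrier: "x mod int n \<in> carrier (Zn n)" for x
    using n_pos by (simp add: Zn_def)
  have one: "(\<alpha> mod int n) \<otimes>\<^bsub>Zn n\<^esub> (\<beta> mod int n) = \<one>\<^bsub>Zn n\<^esub>"
    "(\<beta> mod int n) \<otimes>\<^bsub>Zn n\<^esub> (\<alpha> mod int n) = \<one>\<^bsub>Zn n\<^esub>"
    using ab by (simp_all add: Zn_def cong_def mod_mult_eq mult.commute)
  show "\<alpha> mod int n \<in> Units (Zn n)"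
    using carrier one unfolding Units_def by blast
  show "inv\<^bsub>Zn n\<^esub> (\<alpha> mod int n) = \<beta> mod int n"
    using monoid.inv_unique' [OF monoid_Zn carrier carrier one] by simp
qed

definition mulrow :: "nat \<Rightarrow> int \<Rightarrow> (nat \<Rightarrow> int) \<Rightarrow> nat \<Rightarrow> int" where
  "mulrow j a v = (\<lambda>i. if i = j then a * v i else v i)"

lemma linear_map_mulrow: "linear_map (mulrow j a)"
  unfolding linear_map_def mulrow_def using sum_std [where c = 1] by (auto simp: sum_std)

lemma row_mult_op_mat: "j < 2 * m \<Longrightarrow> row_mult m n j (a mod int n) = op_mat (mulrow j a)"
  by (intro eq_matI)
    (auto simp: row_mult_def reduce_mat_def multrow_mat_def op_mat_def col_mat_def mulrow_def std_def)

lemma M_op_op_mat: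
  assumes j: "j < 2 * m" and ab: "[\<alpha> * \<beta> = 1] (mod int n)"
  shows "M_op m n j (\<alpha> mod int n) = op_mat (dil m j \<alpha> \<beta>)"
proof -
  have "mulrow j \<alpha> \<circ> mulrow (partner m j) \<beta> = dil m j \<alpha> \<beta>"
    using j by (auto simp: fun_eq_iff mulrow_def dil_def)
  then show ?thesis
    using j by (simp add: M_op_def Units_Zn [OF ab] mult_GL row_mult_op_mat op_mat_mult linear_map_mulrow)
qed

section \<open>The symplectic condition on columns\<close>

lemma sigma_mat_index:
  "k < 2 * m \<Longrightarrow> l < 2 * m \<Longrightarrow> sigma_mat m $$ (k, l) = - half_sign m k * std (partner m k) l"
  by (auto simp: sigma_mat_def half_sign_def std_def partner_eq)

text \<open>\<open>G\<close> holds the reduced entries, which are those of the matrix, so the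
  equation is exact in the integers; congruence enters only in \<open>col_mat_Sp\<close>.\<close>

lemma transpose_sigma_index:
  assumes F: "\<And>c i. G c i = F c i mod int n" and "c < 2 * m" "c' < 2 * m"
  shows "(transpose_mat (col_mat F) * sigma_mat m * col_mat F) $$ (c, c') = omega m (G c) (G c')"
proof -
  let ?S = "col_mat F"
  have S: "?S \<in> carrier_mat (2 * m) (2 * m)" and sigma: "sigma_mat m \<in> carrier_mat (2 * m) (2 * m)"
    by (auto simp: col_mat_def sigma_mat_def)
  have ent: "?S $$ (i, c) = G c i" if "i < 2 * m" "c < 2 * m" for i c
    using that by (simp add: col_mat_def F)
  have "(sigma_mat m * ?S) $$ (k, c') = - half_sign m k * G c' (partner m k)" if k: "k < 2 * m" for k
  proof -
    have "(sigma_mat m * ?S) $$ (k, c') = (\<Sum>l<2 * m. - half_sign m k * std (partner m k) l * G c' l)"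
      using S sigma k assms(3)
      by (auto simp: scalar_prod_def atLeast0LessThan ent sigma_mat_index intro!: sum.cong)
    also have "\<dots> = - half_sign m k * G c' (partner m k)"
      using k by (simp add: std_def if_distrib if_distribR cong: if_cong)
    finally show ?thesis .
  qed
  note sigma_S = this
  have "transpose_mat ?S * sigma_mat m * ?S = transpose_mat ?S * (sigma_mat m * ?S)"
    using S sigma by (intro assoc_mult_mat) auto
  also have "\<dots> $$ (c, c') = (\<Sum>k<2 * m. G c k * (sigma_mat m * ?S) $$ (k, c'))"
  proof -
    have "(transpose_mat ?S * B) $$ (c, c') = (\<Sum>k<2 * m. G c k * B $$ (k, c'))"
      if "B \<in> carrier_mat (2 * m) (2 * m)" for B
      using that S assms(2,3)
      by (auto simp: scalar_prod_def atLeast0LessThan ent intro!: sum.cong)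
    then show ?thesis
      using S sigma by simp
  qed
  also have "\<dots> = omega m (G c) (G c')"
    unfolding omega_def by (intro sum.cong) (auto simp: sigma_S simp del: index_mult_mat(1))
  finally show ?thesis .
qed

lemma col_mat_Sp: "col_mat F \<in> carrier (Sp m n) \<longleftrightarrow> symplectic_columns F"
proof -
  let ?S = "col_mat F" and ?G = "\<lambda>c i. F c i mod int n"
  have dim: "dim_row ?S = 2 * m" "dim_col ?S = 2 * m" "sigma_mat m \<in> carrier_mat (2 * m) (2 * m)"
    by (auto simp: col_mat_def sigma_mat_def)
  have sigma: "sigma_mat m $$ (c, c') = omega m (std c) (std c')" if "c < 2 * m" "c' < 2 * m" for c c'
    using that by (auto simp: sigma_mat_index omega_std_left std_def)
  have om: "[omega m (?G c) (?G c') = omega m (F c) (F c')] (mod int n)" for c c'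
    by (intro omega_cong) (auto simp: veq_def cong_def)
  have "?S \<in> carrier (Sp m n) \<longleftrightarrow>
    reduce_mat n (transpose_mat ?S * sigma_mat m * ?S) = reduce_mat n (sigma_mat m)"
    by (simp add: Sp_def)
  also have "\<dots> \<longleftrightarrow> (\<forall>c<2 * m. \<forall>c'<2 * m.
    (transpose_mat ?S * sigma_mat m * ?S) $$ (c, c') mod int n = sigma_mat m $$ (c, c') mod int n)"
    using dim by (auto simp: reduce_mat_def mat_eq_iff simp del: index_mult_mat(1))
  also have "\<dots> \<longleftrightarrow> (\<forall>c<2 * m. \<forall>c'<2 * m.
    omega m (?G c) (?G c') mod int n = omega m (std c) (std c') mod int n)"
    by (simp add: transpose_sigma_index [of ?G F] sigma)
  also have "\<dots> \<longleftrightarrow> symplectic_columns F"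
    using om unfolding symplectic_columns_def cong_def by simp
  finally show ?thesis .
qed

lemma op_mat_act_Sp: "valid s \<Longrightarrow> op_mat (act m s) \<in> carrier (Sp m n)"
  unfolding op_mat_def col_mat_Sp symplectic_columns_def by (auto intro: omega_act)

section \<open>Expansion into symplectic row operations\<close>

fun unit_op :: "sop \<Rightarrow> bool" where
  "unit_op (Trans j k a) \<longleftrightarrow> a \<in> {1, -1}"
| "unit_op (Dil j \<alpha> \<beta>) \<longleftrightarrow> True"

text \<open>Coefficients 1 and -1 give \<open>C_op\<close> and its inverse, and dilations give
  \<open>M_op\<close>; membership in the symplectic group comes from
  \<open>omega_act\<close>.\<close>

lemma symplectic_row_ops_op_mat:
  assumes "valid s" "unit_op s"
  shows "op_mat (act m s) \<in> symplectic_row_ops m n"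
proof -
  have "op_mat (act m s) \<in> row_ops m n"
  proof (cases s)
    case (Trans j k a)
    then have jk: "j < 2 * m" "k < 2 * m" "j \<noteq> k"
      using assms by auto
    have "op_mat (transvec m j k 1) \<in> row_ops m n" "op_mat (transvec m j k (- 1)) \<in> row_ops m n"
      using row_ops.C [OF jk, of n] row_ops.C_inv [OF jk, of n] C_op_op_mat [OF jk] inv_C_op [OF jk]
      by simp_all
    then show ?thesis
      using Trans assms by auto
  next
    case (Dil j \<alpha> \<beta>)
    then have *: "j < 2 * m" "[\<alpha> * \<beta> = 1] (mod int n)"
      using assms by auto
    then show ?thesis
      using row_ops.M [OF *(1) Units_Zn(1) [OF *(2)]] Dil M_op_op_mat by simp
  qed
  then show ?thesis
    using assms op_mat_act_Sp by (simp add: symplectic_row_ops_def)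
qed

text \<open>A transvection with coefficient \<open>s * u\<^sup>2\<close> is the conjugate of the one with coefficient \<open>s\<close>
  by a dilation: by \<open>u\<close> if the two rows are partners, and by \<open>u\<^sup>2\<close> otherwise.\<close>

lemma transvec_signed_square:
  assumes jk: "j < 2 * m" "k < 2 * m" "j \<noteq> k" and s: "s \<in> {1, -1}" and u: "coprime u (int n)"
  shows "\<exists>ss. length ss = 3 \<and> (\<forall>s\<in>set ss. valid s \<and> unit_op s) \<and>
    (\<forall>v. acts ss v \<simeq> transvec m j k (s * u\<^sup>2) v)"
proof -
  \<comment> \<open>If \<open>k\<close> is the partner of \<open>j\<close>, the dilations scale both
    the source and the target row, so the coefficient picks up \<open>w\<close> twice; otherwise row
    \<open>k\<close> is not scaled and it picks up \<open>w\<close> once.\<close>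
  define w where "w = (if k = partner m j then u else u\<^sup>2)"
  have "coprime w (int n)"
    using u by (simp add: w_def)
  then obtain b where b: "[w * b = 1] (mod int n)"
    using cong_solve_coprime_int by blast
  define ss where "ss = [Dil j w b, Trans j k s, Dil j b w]"
  have wb: "[w * (b * x) = x] (mod int n)" for x
    using cong_mult [OF b cong_refl [of x]] by (simp add: ac_simps)
  have "acts ss v \<simeq> transvec m j k (s * u\<^sup>2) v" for v
    unfolding veq_def
  proof (intro allI impI)
    fix i assume "i < 2 * m"
    show "[acts ss v i = transvec m j k (s * u\<^sup>2) v i] (mod int n)"
    proof (cases "k = partner m j")
      case True
      have "acts ss v i = (if i = j then b * (w * v i)
        else if i = k then w * (b * v i) + s * u\<^sup>2 * v j else v i)"
        using True jk by (auto simp: ss_def dil_def transvec_def std_def w_def power2_eq_square algebra_simps)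
      moreover have "transvec m j k (s * u\<^sup>2) v i = (if i = k then v i + s * u\<^sup>2 * v j else v i)"
        using True by (simp add: transvec_def std_def)
      ultimately show ?thesis
        using jk wb [of "v i"] by (auto simp: mult.left_commute intro: cong_add)
    next
      case False
      have "acts ss v i = (if i = j then b * (w * v i)
        else if i = k then v i + s * u\<^sup>2 * v j
        else if i = partner m j then w * (b * v i) - half_sign m j * half_sign m k * (s * u\<^sup>2) * v (partner m k)
        else v i)"
        using False jk by (auto simp: ss_def dil_def transvec_def std_def w_def algebra_simps partner_swap [of _ _ j])
      moreover have "transvec m j k (s * u\<^sup>2) v i = (if i = k then v i + s * u\<^sup>2 * v j
        else if i = partner m j then v i - half_sign m j * half_sign m k * (s * u\<^sup>2) * v (partner m k) else v i)"
        using False by (simp add: transvec_def std_def)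
      ultimately show ?thesis
        using jk False wb [of "v i"] by (auto simp: mult.left_commute intro: cong_diff)
    qed
  qed
  moreover have "\<forall>s\<in>set ss. valid s \<and> unit_op s"
    using jk s b by (auto simp: ss_def mult.commute)
  ultimately show ?thesis
    by (intro exI [of _ ss]) (simp add: ss_def)
qed

text \<open>A transvection does not write to the rows that it reads, so a second one sees the same
  values. Sums of signed squares thus become concatenated lists of operations.\<close>

lemma transvec_add:
  assumes "j < 2 * m" "k < 2 * m" "j \<noteq> k"
  shows "transvec m j k b (transvec m j k a v) = transvec m j k (a + b) v"
  using assms by (auto simp: fun_eq_iff transvec_def std_def partner_swap [of k] algebra_simps)

lemma transvec_signed_squares:
  assumes jk: "j < 2 * m" "k < 2 * m" "j \<noteq> k"
    and us: "\<forall>(s, u)\<in>set us. s \<in> {1, -1} \<and> coprime u (int n)"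
  shows "\<exists>ss. length ss = 3 * length us \<and> (\<forall>s\<in>set ss. valid s \<and> unit_op s) \<and>
    (\<forall>v. acts ss v \<simeq> transvec m j k (signed_squares us) v)"
  using us
proof (induction us)
  case Nil
  then show ?case
    by (intro exI [of _ "[]"]) (simp add: veq_def transvec_def)
next
  case (Cons x us)
  obtain s u where x: "x = (s, u)"
    by (cases x)
  obtain s1 where s1: "length s1 = 3" "\<forall>s\<in>set s1. valid s \<and> unit_op s"
    "\<And>v. acts s1 v \<simeq> transvec m j k (s * u\<^sup>2) v"
    using transvec_signed_square [OF jk, of s u] Cons.prems x by auto
  obtain s2 where s2: "length s2 = 3 * length us" "\<forall>s\<in>set s2. valid s \<and> unit_op s"
    "\<And>v. acts s2 v \<simeq> transvec m j k (signed_squares us) v"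
    using Cons by auto
  have "acts (s1 @ s2) v \<simeq> transvec m j k (signed_squares (x # us)) v" for v
  proof -
    have "acts s2 (acts s1 v) \<simeq> acts s2 (transvec m j k (s * u\<^sup>2) v)"
      using s1(3) s2(2) acts_cong by blast
    then have "acts s2 (acts s1 v) \<simeq> transvec m j k (signed_squares us) (transvec m j k (s * u\<^sup>2) v)"
      using s2(3) veq_trans by blast
    then show ?thesis
      by (simp add: x transvec_add [OF jk])
  qed
  then show ?case
    using s1 s2 by (intro exI [of _ "s1 @ s2"]) auto
qed

lemma expand_op:
  assumes "valid s"
  shows "\<exists>ss. length ss \<le> 81 \<and> (\<forall>s\<in>set ss. valid s \<and> unit_op s) \<and> (\<forall>v. acts ss v \<simeq> act m s v)"
proof (cases s)
  case (Trans j k a)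
  obtain us where us: "length us \<le> 27" "\<forall>(s, u) \<in> set us. s \<in> {1, -1} \<and> coprime u (int n)"
    "signed_squares us = a"
    using signed_sum_of_27_unit_squares [OF n_pos] by blast
  from Trans assms obtain ss where "length ss = 3 * length us" "\<forall>s\<in>set ss. valid s \<and> unit_op s"
    "\<forall>v. acts ss v \<simeq> transvec m j k (signed_squares us) v"
    using transvec_signed_squares [OF _ _ _ us(2), of j k] by auto
  with us Trans show ?thesis
    by (intro exI [of _ ss]) auto
next
  case (Dil j \<alpha> \<beta>)
  with assms show ?thesis
    by (intro exI [of _ "[s]"]) auto
qed

lemma expand_ops:
  assumes "\<forall>s\<in>set ss. valid s"
  shows "\<exists>ts. length ts \<le> 81 * length ss \<and> (\<forall>s\<in>set ts. valid s \<and> unit_op s) \<and>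
    (\<forall>v. acts ts v \<simeq> acts ss v)"
  using assms
proof (induction ss)
  case Nil
  then show ?case
    by (intro exI [of _ "[]"]) simp
next
  case (Cons s ss)
  obtain t1 where t1: "length t1 \<le> 81" "\<forall>s\<in>set t1. valid s \<and> unit_op s" "\<And>v. acts t1 v \<simeq> act m s v"
    using expand_op Cons.prems by (metis list.set_intros(1))
  obtain t2 where t2: "length t2 \<le> 81 * length ss" "\<forall>s\<in>set t2. valid s \<and> unit_op s"
    "\<And>v. acts t2 v \<simeq> acts ss v"
    using Cons by auto
  have "acts (t1 @ t2) v \<simeq> acts (s # ss) v" for v
  proof -
    have "acts t2 (acts t1 v) \<simeq> acts t2 (act m s v)"
      using t1(3) t2(2) acts_cong by blast
    then show ?thesis
      using t2(3) veq_trans by (metis acts_simps(2,3))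
  qed
  then show ?case
    using t1 t2 by (intro exI [of _ "t1 @ t2"]) auto
qed

text \<open>If operations applied from the head of the list onwards bring the columns to the
  identity, the matrix is the product of their inverses with that of the head leftmost, which is the
  order of \<open>foldr\<close>. Negating a coefficient 1 or -1 and swapping the factors of a
  dilation again give row operations.\<close>

lemma product_of_inverse_ops:
  assumes "\<forall>s\<in>set ss. valid s \<and> unit_op s" "\<And>c. c < 2 * m \<Longrightarrow> acts ss (F c) \<simeq> std c"
  shows "\<exists>ops. set ops \<subseteq> symplectic_row_ops m n \<and> length ops = length ss \<and>
    col_mat F = foldr (\<lambda>A B. A \<otimes>\<^bsub>Sp m n\<^esub> B) ops \<one>\<^bsub>Sp m n\<^esub>"
  using assms
proof (induction ss arbitrary: F)
  case Nil
  then have "col_mat F = col_mat std"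
    by (intro col_mat_cong) simp
  then show ?case
    by (intro exI [of _ "[]"]) (simp add: one_Sp)
next
  case (Cons s ss)
  define t where "t = inverse_op s"
  have t: "valid t" "unit_op t"
    using Cons.prems(1) by (cases s; force simp: t_def mult.commute)+
  obtain ops where ops: "set ops \<subseteq> symplectic_row_ops m n" "length ops = length ss"
    "col_mat (\<lambda>c. act m s (F c)) = foldr (\<lambda>A B. A \<otimes>\<^bsub>Sp m n\<^esub> B) ops \<one>\<^bsub>Sp m n\<^esub>"
    using Cons.IH [of "\<lambda>c. act m s (F c)"] Cons.prems by auto
  have "op_mat (act m t) \<otimes>\<^bsub>Sp m n\<^esub> col_mat (\<lambda>c. act m s (F c))
    = col_mat (\<lambda>c. act m t (act m s (F c)))"
    by (simp add: mult_Sp op_mat_mult_cols linear_map_act t)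
  also have "\<dots> = col_mat F"
    using act_inverse_op [OF t(1)] by (intro col_mat_cong) (simp add: t_def)
  finally show ?case
    using ops symplectic_row_ops_op_mat [OF t]
    by (intro exI [of _ "op_mat (act m t) # ops"]) simp
qed

lemma Sp_product_of_row_ops:
  assumes S: "S \<in> carrier (Sp m n)"
  shows "\<exists>ops. set ops \<subseteq> symplectic_row_ops m n \<and> length ops \<le> 486 * m\<^sup>2 \<and>
    S = foldr (\<lambda>A B. A \<otimes>\<^bsub>Sp m n\<^esub> B) ops \<one>\<^bsub>Sp m n\<^esub>"
proof -
  have "S \<in> carrier MZ"
    using S by (simp add: Sp_def)
  then obtain F where F: "S = col_mat F"
    by (rule that [OF col_mat_index])
  then have "symplectic_columns F"
    using S col_mat_Sp by simp
  moreover have "partner m ` {..<2 * m} \<subseteq> {..<2 * m}"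
    by auto
  ultimately obtain ss where ss: "length ss \<le> 3 * m * card {..<2 * m}" "\<forall>s\<in>set ss. valid s"
    "\<forall>c<2 * m. acts ss (F c) \<simeq> std c"
    using reduce_to_standard [of "{..<2 * m}" F] by auto
  obtain ts where ts: "length ts \<le> 81 * length ss" "\<forall>s\<in>set ts. valid s \<and> unit_op s"
    "\<And>v. acts ts v \<simeq> acts ss v"
    using expand_ops [OF ss(2)] by blast
  have "acts ts (F c) \<simeq> std c" if "c < 2 * m" for c
    using ts(3) ss(3) that veq_trans by blast
  from product_of_inverse_ops [OF ts(2) this]
  obtain ops where ops: "set ops \<subseteq> symplectic_row_ops m n" "length ops = length ts"
    "col_mat F = foldr (\<lambda>A B. A \<otimes>\<^bsub>Sp m n\<^esub> B) ops \<one>\<^bsub>Sp m n\<^esub>"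
    by blast
  \<comment> \<open>At most \<open>3 * m * (2 * m)\<close> operations reduce the columns, and each
    expands into at most 81.\<close>
  have "length ops \<le> 486 * m\<^sup>2"
    using ops(2) ts(1) ss(1) by (simp add: power2_eq_square)
  with ops F show ?thesis
    by blast
qed

end

theorem mainTheorem5:
  shows "\<exists>c::real. c > 0 \<and>
    (\<forall>m n :: nat. m \<ge> 1 \<longrightarrow> n \<ge> 1 \<longrightarrow>
      (\<forall>S \<in> carrier (Sp m n).
        \<exists>ops :: int mat list.
          set ops \<subseteq> symplectic_row_ops m n \<and>
          real (length ops) \<le> c * (real m)\<^sup>2 \<and>
          S = foldr (\<lambda>A B. A \<otimes>\<^bsub>Sp m n\<^esub> B) ops \<one>\<^bsub>Sp m n\<^esub>))"
proof (intro exI [of _ 486] conjI allI impI ballI)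
  fix m n :: nat and S assume "m \<ge> 1" "n \<ge> 1" and S: "S \<in> carrier (Sp m n)"
  then interpret symplectic_mod m n
    by unfold_locales auto
  obtain ops where ops: "set ops \<subseteq> symplectic_row_ops m n" "length ops \<le> 486 * m\<^sup>2"
    "S = foldr (\<lambda>A B. A \<otimes>\<^bsub>Sp m n\<^esub> B) ops \<one>\<^bsub>Sp m n\<^esub>"
    using Sp_product_of_row_ops [OF S] by blast
  from ops(2) have "real (length ops) \<le> real (486 * m\<^sup>2)"
    by (simp only: of_nat_le_iff)
  with ops show "\<exists>ops. set ops \<subseteq> symplectic_row_ops m n \<and> real (length ops) \<le> 486 * (real m)\<^sup>2 \<and>
    S = foldr (\<lambda>A B. A \<otimes>\<^bsub>Sp m n\<^esub> B) ops \<one>\<^bsub>Sp m n\<^esub>"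
    by (intro exI [of _ ops]) simp
qed simp

end
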